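(* Let $G$ be a graph with $n$ vertices, $m$ edges, and maximum degree $\Delta$, which has exactly $\tau$ tight components. Then $G$ has a bisection of size at least $$\frac{m}{2} + \frac{n - \max\{\tau, \Delta - 1\}}{4}.$$
   Context: Graphs are finite and simple. A bisection of a graph is a bipartition $V = V_1 \cup V_2$ of its vertex set into disjoint parts with $\big||V_1|-|V_2|\big| \le 1$; its size is the number $e(V_1,V_2)$ of edges with one endpoint in each part. A connected component $T$ of a graph is called a tight component if: (i) for every vertex $v \in T$, the subgraph induced by $T \setminus \{v\}$ contains a perfect matching; and (ii) for every vertex $v \in T$ and every perfect matching of $T \setminus \{v\}$, no edge of the matching has exactly one endpoint adjacent to $v$. (In particular, an isolated vertex is a tight component; the empty graph has the empty perfect matching.) *)

theory Defs
  imports Complex_Main "Graph_Theory.Digraph_Component"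
begin

text \<open>
  Finite simple graphs are those of the locale \<^locale>\<open>graph\<close>: finite, loop-free, symmetric
  digraphs without parallel arcs. Every undirected edge is thus represented by a pair of
  opposite arcs, so edges are counted as two-element sets of vertices, while the degree of
  a vertex is its out-degree and the components are the vertex sets in
  \<^const>\<open>pre_digraph.sccs_verts\<close>.
\<close>

definition uedges :: "('a, 'b) pre_digraph \<Rightarrow> 'a set set" where
  "uedges G = {{tail G a, head G a} | a. a \<in> arcs G}"

text \<open>The null graph has maximum degree 0.\<close>

definition max_degree :: "('a, 'b) pre_digraph \<Rightarrow> nat" where
  "max_degree G = Max (insert 0 (out_degree G ` verts G))"

definition bisection :: "('a, 'b) pre_digraph \<Rightarrow> 'a set \<Rightarrow> 'a set \<Rightarrow> bool" where
  "bisection G V1 V2 \<longleftrightarrow>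
     V1 \<union> V2 = verts G \<and> V1 \<inter> V2 = {} \<and> \<bar>int (card V1) - int (card V2)\<bar> \<le> 1"

definition edges_between :: "('a, 'b) pre_digraph \<Rightarrow> 'a set \<Rightarrow> 'a set \<Rightarrow> 'a set set" where
  "edges_between G V1 V2 = {e \<in> uedges G. \<exists>u\<in>V1. \<exists>v\<in>V2. e = {u, v}}"

definition perfect_matching :: "('a, 'b) pre_digraph \<Rightarrow> 'a set set \<Rightarrow> bool" where
  "perfect_matching G M \<longleftrightarrow> M \<subseteq> uedges G \<and> (\<forall>v\<in>verts G. \<exists>!e. e \<in> M \<and> v \<in> e)"

definition tight_component :: "('a, 'b) pre_digraph \<Rightarrow> 'a set \<Rightarrow> bool" where
  "tight_component G T \<longleftrightarrow>
     T \<in> pre_digraph.sccs_verts G \<and>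
     (\<forall>v\<in>T. \<exists>M. perfect_matching (G \<restriction> (T - {v})) M) \<and>
     (\<forall>v\<in>T. \<forall>M. perfect_matching (G \<restriction> (T - {v})) M \<longrightarrow>
        (\<forall>e\<in>M. \<not> (\<exists>!x. x \<in> e \<and> x \<rightarrow>\<^bsub>G\<^esub> v)))"

end

theory Submission
  imports Defs
begin

text \<open>
  A signing \<open>s\<close> of the vertices by \<open>1\<close> and \<open>-1\<close> cuts
  \<open>m / 2 - Q / 4\<close> edges, where \<open>Q\<close> sums \<open>s u * s v\<close> over ordered adjacent pairs.
  Take a maximum matching with exposed set \<open>W\<close> and give matched vertices opposite signs, so that
  every matching edge contributes \<open>-2\<close> to \<open>Q\<close>. Two exposed vertices that see some matching
  edge differently can be joined to that edge as one cluster, with opposite signs chosen so that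
  the pair contributes \<open>-2\<close> or less as well; the interaction between distinct
  clusters is removed by choosing the cluster signs one after the other. In a maximal family of
  such pairs the leftover exposed vertices all see every matching edge in the same way. If
  they see exactly one endpoint of some matching edge, they are all neighbours of that endpoint, as
  is its partner, so there are at most \<open>\<Delta> - 1\<close> of them. Otherwise they are ``neutral'',
  and if the maximum matching is chosen with the fewest neutral vertices, then an exchange argument
  along alternating paths shows that each neutral vertex lies in its own tight component.
\<close>

section \<open>Sign choices\<close>

text \<open>Under independent random signs the off-diagonal terms average to zero; the induction
  derandomises this by fixing one sign at a time.\<close>

lemma exists_signs_le_diagonal:
  fixes q :: "'i \<Rightarrow> 'i \<Rightarrow> real"
  assumes "finite I"
  shows "\<exists>\<epsilon>. (\<forall>i. \<epsilon> i = 1 \<or> \<epsilon> i = -1) \<and>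
    (\<Sum>i\<in>I. \<Sum>j\<in>I. q i j * \<epsilon> i * \<epsilon> j) \<le> (\<Sum>i\<in>I. q i i)"
  using assms
proof (induction I rule: finite_induct)
  case empty
  then show ?case by (intro exI[of _ "\<lambda>_. 1"]) auto
next
  case (insert x I)
  then obtain \<epsilon> where sg: "\<And>i. \<epsilon> i = 1 \<or> \<epsilon> i = -1"
    and le: "(\<Sum>i\<in>I. \<Sum>j\<in>I. q i j * \<epsilon> i * \<epsilon> j) \<le> (\<Sum>i\<in>I. q i i)" by blast
  \<comment> \<open>The enlarged sum is affine in the new sign \<open>t\<close> with slope
    \<open>L\<close>, because \<open>t * t = 1\<close>; the sign is chosen so that
    \<open>t * L \<le> 0\<close>.\<close>
  define L where "L = (\<Sum>j\<in>I. q x j * \<epsilon> j) + (\<Sum>i\<in>I. q i x * \<epsilon> i)"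
  define t :: real where "t = (if L \<ge> 0 then -1 else 1)"
  define \<delta> where "\<delta> = \<epsilon>(x := t)"
  have on_I: "\<delta> i = \<epsilon> i" if "i \<in> I" for i
    using that insert.hyps by (auto simp: \<delta>_def)
  have "(\<Sum>i\<in>insert x I. \<Sum>j\<in>insert x I. q i j * \<delta> i * \<delta> j)
      = q x x * t * t + (\<Sum>j\<in>I. q x j * t * \<epsilon> j) + (\<Sum>i\<in>I. q i x * \<epsilon> i * t)
        + (\<Sum>i\<in>I. \<Sum>j\<in>I. q i j * \<epsilon> i * \<epsilon> j)"
    using insert.hyps by (simp add: sum.distrib on_I cong: sum.cong) (simp add: \<delta>_def)
  also have "\<dots> = q x x * t * t + t * L + (\<Sum>i\<in>I. \<Sum>j\<in>I. q i j * \<epsilon> i * \<epsilon> j)"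
    by (simp add: L_def sum_distrib_left algebra_simps)
  also have "\<dots> \<le> q x x + (\<Sum>i\<in>I. q i i)"
    using le by (simp add: t_def)
  finally have "(\<Sum>i\<in>insert x I. \<Sum>j\<in>insert x I. q i j * \<delta> i * \<delta> j) \<le> (\<Sum>i\<in>insert x I. q i i)"
    using insert.hyps by simp
  moreover have "\<forall>i. \<delta> i = 1 \<or> \<delta> i = -1"
    using sg by (auto simp: \<delta>_def t_def)
  ultimately show ?case by blast
qed

text \<open>Grouping by clusters turns the sum into a quadratic form in the cluster signs whose
  diagonal is the within-cluster part, so the interaction between distinct clusters can be
  discarded.\<close>

lemma exists_cluster_signs:
  fixes a :: "'a \<Rightarrow> 'a \<Rightarrow> real" and \<kappa> :: "'a \<Rightarrow> 'k"
  assumes "finite V"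
  shows "\<exists>\<epsilon>. (\<forall>i. \<epsilon> i = 1 \<or> \<epsilon> i = -1) \<and>
    (\<Sum>u\<in>V. \<Sum>v\<in>V. a u v * \<epsilon> (\<kappa> u) * \<epsilon> (\<kappa> v))
      \<le> (\<Sum>u\<in>V. \<Sum>v\<in>V. if \<kappa> u = \<kappa> v then a u v else 0)"
proof -
  define cl where "cl i = {v \<in> V. \<kappa> v = i}" for i
  define q where "q i j = (\<Sum>u\<in>cl i. \<Sum>v\<in>cl j. a u v)" for i j
  have grp: "(\<Sum>v\<in>V. g v) = (\<Sum>i\<in>\<kappa> ` V. \<Sum>v\<in>cl i. g v)" for g :: "'a \<Rightarrow> real"
    unfolding cl_def using assms by (rule sum.image_gen)
  obtain \<epsilon> where sg: "\<And>i. \<epsilon> i = 1 \<or> \<epsilon> i = -1"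
    and le: "(\<Sum>i\<in>\<kappa> ` V. \<Sum>j\<in>\<kappa> ` V. q i j * \<epsilon> i * \<epsilon> j) \<le> (\<Sum>i\<in>\<kappa> ` V. q i i)"
    using exists_signs_le_diagonal[of "\<kappa> ` V" q] assms by auto
  have "(\<Sum>u\<in>V. \<Sum>v\<in>V. a u v * \<epsilon> (\<kappa> u) * \<epsilon> (\<kappa> v))
      = (\<Sum>i\<in>\<kappa> ` V. \<Sum>u\<in>cl i. \<Sum>j\<in>\<kappa> ` V. \<Sum>v\<in>cl j. a u v * \<epsilon> (\<kappa> u) * \<epsilon> (\<kappa> v))"
    by (simp only: grp)
  also have "\<dots> = (\<Sum>i\<in>\<kappa> ` V. \<Sum>u\<in>cl i. \<Sum>j\<in>\<kappa> ` V. \<Sum>v\<in>cl j. a u v * \<epsilon> i * \<epsilon> j)"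
    by (intro sum.cong refl) (auto simp: cl_def)
  also have "\<dots> = (\<Sum>i\<in>\<kappa> ` V. \<Sum>j\<in>\<kappa> ` V. q i j * \<epsilon> i * \<epsilon> j)"
    unfolding q_def sum_distrib_right by (intro sum.cong refl sum.swap)
  also have "\<dots> \<le> (\<Sum>i\<in>\<kappa> ` V. q i i)"
    by (rule le)
  also have "\<dots> = (\<Sum>i\<in>\<kappa> ` V. \<Sum>u\<in>cl i. \<Sum>v\<in>cl i. a u v)"
    by (simp add: q_def)
  also have "\<dots> = (\<Sum>i\<in>\<kappa> ` V. \<Sum>u\<in>cl i. \<Sum>v\<in>V. if \<kappa> u = \<kappa> v then a u v else 0)"
  proof (rule sum.cong[OF refl], rule sum.cong[OF refl])
    fix i u assume "u \<in> cl i"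
    then have "cl i = {v \<in> V. \<kappa> u = \<kappa> v}" by (auto simp: cl_def)
    then show "(\<Sum>v\<in>cl i. a u v) = (\<Sum>v\<in>V. if \<kappa> u = \<kappa> v then a u v else 0)"
      using assms by (simp add: sum.inter_filter)
  qed
  also have "\<dots> = (\<Sum>u\<in>V. \<Sum>v\<in>V. if \<kappa> u = \<kappa> v then a u v else 0)"
    by (simp only: grp[symmetric])
  finally show ?thesis using sg by blast
qed

section \<open>Pairings\<close>

text \<open>
  A matching is encoded as an involution whose fixed points are the unmatched elements.
\<close>

definition pairing :: "'a set \<Rightarrow> ('a \<Rightarrow> 'a \<Rightarrow> bool) \<Rightarrow> ('a \<Rightarrow> 'a) \<Rightarrow> bool" where
  "pairing A R f \<longleftrightarrow> (\<forall>x\<in>A. f x \<in> A \<and> f (f x) = x \<and> (f x \<noteq> x \<longrightarrow> R x (f x)))"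

definition unpaired :: "'a set \<Rightarrow> ('a \<Rightarrow> 'a) \<Rightarrow> 'a set" where
  "unpaired A f = {x \<in> A. f x = x}"

lemma pairingD:
  assumes "pairing A R f" "x \<in> A"
  shows "f x \<in> A" "f (f x) = x" "f x \<noteq> x \<Longrightarrow> R x (f x)"
  using assms by (auto simp: pairing_def)

lemma pairing_id: "pairing A R id"
  by (simp add: pairing_def)

lemma pairing_join:
  assumes f: "pairing A R f" and vw: "v \<in> unpaired A f" "w \<in> unpaired A f" "v \<noteq> w"
    and R: "R v w" "R w v"
  shows "pairing A R (f(v := w, w := v))"
    and "unpaired A (f(v := w, w := v)) = unpaired A f - {v, w}"
proof -
  have ne: "f x \<noteq> v" "f x \<noteq> w" if "x \<in> A" "x \<noteq> v" "x \<noteq> w" for x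
    using pairingD(2)[OF f \<open>x \<in> A\<close>] vw that by (auto simp: unpaired_def)
  show "pairing A R (f(v := w, w := v))"
    using f vw R ne by (auto simp: pairing_def unpaired_def)
  show "unpaired A (f(v := w, w := v)) = unpaired A f - {v, w}"
    using vw by (auto simp: unpaired_def)
qed

text \<open>One step of an alternating path: \<open>v\<close> takes over the partner of
  \<open>u\<close>, which moves the hole from \<open>v\<close> to \<open>u\<close>.\<close>

lemma pairing_swap:
  assumes f: "pairing A R f" and v: "v \<in> unpaired A f" and u: "u \<in> A" "f u \<noteq> u"
    and R: "R v (f u)" "R (f u) v"
  shows "pairing A R (f(u := u, v := f u, f u := v))"
    and "unpaired A (f(u := u, v := f u, f u := v)) = insert u (unpaired A f - {v})"
proof -
  note fu = pairingD[OF f \<open>u \<in> A\<close>]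
  have v': "v \<in> A" "f v = v" "v \<noteq> u" "v \<noteq> f u" using v u fu by (auto simp: unpaired_def)
  have ne: "f x \<noteq> u" "f x \<noteq> v" "f x \<noteq> f u" if "x \<in> A" "x \<noteq> u" "x \<noteq> v" "x \<noteq> f u" for x
    using pairingD(2)[OF f \<open>x \<in> A\<close>] fu v' that by auto
  show "pairing A R (f(u := u, v := f u, f u := v))"
    unfolding pairing_def
  proof (intro ballI)
    fix x assume x: "x \<in> A"
    show "(f(u := u, v := f u, f u := v)) x \<in> A \<and>
        (f(u := u, v := f u, f u := v)) ((f(u := u, v := f u, f u := v)) x) = x \<and>
        ((f(u := u, v := f u, f u := v)) x \<noteq> x \<longrightarrow> R x ((f(u := u, v := f u, f u := v)) x))"
      using pairingD[OF f x] ne[OF x] fu v' u R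
      by (cases "x = u"; cases "x = v"; cases "x = f u") auto
  qed
  show "unpaired A (f(u := u, v := f u, f u := v)) = insert u (unpaired A f - {v})"
    using fu v' u by (auto simp: unpaired_def)
qed

text \<open>Joining two related unpaired elements would leave fewer unpaired ones.\<close>

lemma minimal_pairing_independent:
  assumes "finite A" "symp R" and f: "pairing A R f"
    and min: "\<And>g. pairing A R g \<Longrightarrow> card (unpaired A f) \<le> card (unpaired A g)"
    and xy: "x \<in> unpaired A f" "y \<in> unpaired A f" "x \<noteq> y"
  shows "\<not> R x y"
proof
  assume "R x y"
  with \<open>symp R\<close> have "R y x" by (rule sympD)
  note j = pairing_join[OF f xy \<open>R x y\<close> this]
  have "finite (unpaired A f)" using \<open>finite A\<close> by (simp add: unpaired_def)
  then have "card (unpaired A f - {x, y}) < card (unpaired A f)"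
    using xy by (intro psubset_card_mono) auto
  with min[OF j(1)] j(2) show False by simp
qed

lemma exists_maximal_pairing:
  assumes "finite A" "symp R"
  shows "\<exists>f. pairing A R f \<and>
    (\<forall>x\<in>unpaired A f. \<forall>y\<in>unpaired A f. x \<noteq> y \<longrightarrow> \<not> R x y)"
proof -
  obtain f where "pairing A R f"
    "\<And>g. pairing A R g \<Longrightarrow> card (unpaired A f) \<le> card (unpaired A g)"
    using ex_has_least_nat[of "pairing A R" id "\<lambda>f. card (unpaired A f)"] pairing_id[of A R]
    by blast
  with minimal_pairing_independent[OF assms] show ?thesis by meson
qed

lemma sum_pairing:
  fixes s :: "'a \<Rightarrow> real"
  assumes "pairing A R f"
  shows "2 * (\<Sum>x\<in>A. s x) = (\<Sum>x\<in>A. s x + s (f x))"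
proof -
  have "(\<Sum>x\<in>A. s (f x)) = (\<Sum>x\<in>A. s x)"
    using assms by (intro sum.reindex_bij_witness[of _ f f]) (auto simp: pairing_def)
  then show ?thesis by (simp add: sum.distrib)
qed

lemma pairing_orientation:
  assumes "pairing A R f"
  shows "\<exists>r :: 'a \<Rightarrow> real. (\<forall>x. r x = 1 \<or> r x = -1) \<and>
    (\<forall>x\<in>A. f x \<noteq> x \<longrightarrow> r (f x) = - r x)"
proof -
  \<comment> \<open>The choice depends only on the set \<open>{x, f x}\<close>, so partners share
    it, and exactly one of two distinct partners is chosen.\<close>
  define rep where "rep x = (SOME y. y \<in> {x, f x})" for x
  have rep: "rep x \<in> {x, f x}" for x
    unfolding rep_def by (rule someI[of _ x]) simp
  have rep_f: "rep (f x) = rep x" if "x \<in> A" for x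
    using pairingD(2)[OF assms that] by (simp add: rep_def insert_commute)
  then have "\<forall>x\<in>A. f x \<noteq> x \<longrightarrow>
      (if f x = rep (f x) then 1 else -1) = - (if x = rep x then 1 else (-1 :: real))"
  proof (intro ballI impI)
    fix x assume "x \<in> A" "f x \<noteq> x"
    then show "(if f x = rep (f x) then 1 else -1) = - (if x = rep x then 1 else (-1 :: real))"
      using rep[of x] rep_f[of x] by auto
  qed
  then show ?thesis
    by (intro exI[of _ "\<lambda>x. if x = rep x then 1 else -1"]) auto
qed

section \<open>Tight components\<close>

context graph
begin

abbreviation matching :: "('a \<Rightarrow> 'a) \<Rightarrow> bool" where
  "matching f \<equiv> pairing (verts G) (\<lambda>u v. u \<rightarrow> v) f"

abbreviation exposed :: "('a \<Rightarrow> 'a) \<Rightarrow> 'a set" where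
  "exposed f \<equiv> unpaired (verts G) f"

definition neutral :: "('a \<Rightarrow> 'a) \<Rightarrow> 'a set" where
  "neutral f = {w \<in> exposed f. \<forall>x\<in>verts G. w \<rightarrow> x \<longleftrightarrow> w \<rightarrow> f x}"

text \<open>A lexicographic minimum: the tie-break on neutral vertices is what forces neutrality to
  survive exchanges.\<close>

definition optimal :: "('a \<Rightarrow> 'a) \<Rightarrow> bool" where
  "optimal f \<longleftrightarrow> matching f \<and> (\<forall>g. matching g \<longrightarrow> card (exposed f) \<le> card (exposed g) \<and>
     (card (exposed g) = card (exposed f) \<longrightarrow> card (neutral f) \<le> card (neutral g)))"

lemma symp_adj: "symp (\<lambda>u v. u \<rightarrow> v)"
  by (auto intro: sympI graph_symmetric)

lemma adj_commute: "u \<rightarrow> v \<longleftrightarrow> v \<rightarrow> u"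
  by (auto intro: graph_symmetric)

lemma not_adj_self: "\<not> u \<rightarrow> u"
  using adj_not_same by blast

lemma adj_verts: "u \<rightarrow> v \<Longrightarrow> u \<in> verts G" "u \<rightarrow> v \<Longrightarrow> v \<in> verts G"
  by (auto dest: adj_in_verts)

lemma finite_exposed: "finite (exposed f)"
  by (simp add: unpaired_def)

lemma neutral_subset: "neutral f \<subseteq> exposed f"
  by (auto simp: neutral_def)

lemma finite_neutral: "finite (neutral f)"
  using neutral_subset finite_exposed by (rule finite_subset)

lemma exists_optimal: "\<exists>f. optimal f"
proof -
  obtain f0 where f0: "matching f0"
    and min0: "\<And>g. matching g \<Longrightarrow> card (exposed f0) \<le> card (exposed g)"
    using ex_has_least_nat[of matching id "\<lambda>f. card (exposed f)"] pairing_id by blast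
  obtain f where f: "matching f" "card (exposed f) = card (exposed f0)"
    and min: "\<And>g. matching g \<Longrightarrow> card (exposed g) = card (exposed f0) \<Longrightarrow>
      card (neutral f) \<le> card (neutral g)"
    using ex_has_least_nat[of "\<lambda>f. matching f \<and> card (exposed f) = card (exposed f0)" f0
        "\<lambda>f. card (neutral f)"] f0 by blast
  show ?thesis
    using f min0 min by (auto simp: optimal_def)
qed

lemma optimalD:
  assumes "optimal f"
  shows "matching f"
    and "matching g \<Longrightarrow> card (exposed f) \<le> card (exposed g)"
    and "matching g \<Longrightarrow> card (exposed g) = card (exposed f) \<Longrightarrow>
      card (neutral f) \<le> card (neutral g)"
  using assms by (auto simp: optimal_def)

lemma optimal_independent:
  assumes "optimal f" "x \<in> exposed f" "y \<in> exposed f"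
  shows "\<not> x \<rightarrow> y"
  using minimal_pairing_independent[OF finite_verts symp_adj, of f x y] optimalD[OF assms(1)]
    assms(2,3) not_adj_self by blast

section \<open>Exchanges along alternating paths\<close>

lemma optimal_transfer:
  assumes f: "optimal f" and g: "matching g"
    and "card (exposed g) = card (exposed f)" "card (neutral g) = card (neutral f)"
  shows "optimal g"
  using assms by (auto simp: optimal_def)

text \<open>A neutral \<open>z\<close> adjacent to \<open>u\<close> is also adjacent to
  \<open>f u\<close>, so it can take over \<open>f u\<close> and expose \<open>u\<close>. This
  creates no neutral vertex other than possibly \<open>u\<close>, while \<open>z\<close> is lost;
  minimality of the neutral count then makes \<open>u\<close> neutral.\<close>

lemma optimal_swap:
  assumes f: "optimal f" and z: "z \<in> neutral f" and zu: "z \<rightarrow> u"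
  shows "\<exists>g. optimal g \<and> u \<in> neutral g \<and> exposed g = insert u (exposed f - {z})"
proof -
  note M = optimalD(1)[OF f]
  have zW: "z \<in> exposed f" using z by (simp add: neutral_def)
  have uV: "u \<in> verts G" using zu by (rule adj_verts)
  have uW: "u \<notin> exposed f" using optimal_independent[OF f zW] zu by blast
  with uV have fu: "f u \<noteq> u" "f u \<in> verts G" "f (f u) = u" "z \<noteq> u"
    using pairingD[OF M uV] zW by (auto simp: unpaired_def)
  have zu': "z \<rightarrow> f u" using z uV zu by (auto simp: neutral_def)
  \<comment> \<open>Either endpoint of the edge \<open>{u, f u}\<close> can be the one exposed. The
    result uses \<open>swap u\<close>, but the maximality of both swaps is needed to see that other
    exposed vertices avoid both endpoints.\<close>
  define swap where "swap x = f(x := x, z := f x, f x := z)" for x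
  have swap: "matching (swap x)" "exposed (swap x) = insert x (exposed f - {z})"
    if "x = u \<or> x = f u" for x
    using pairing_swap[OF M zW, of x] that uV fu zu zu' adj_commute by (auto simp: swap_def)
  have finW: "finite (exposed f)" by (rule finite_exposed)
  have card_swap: "card (exposed (swap x)) = card (exposed f)" if "x = u \<or> x = f u" for x
  proof -
    have "x \<notin> exposed f" using that uW fu by (auto simp: unpaired_def)
    then show ?thesis
      using swap(2)[OF that] zW finW
      by (simp add: card.insert_remove card_gt_0_iff) (metis Suc_pred card_gt_0_iff empty_iff)
  qed
  have no_adj: "\<not> w \<rightarrow> x" if "w \<in> exposed f" "w \<noteq> z" "x = u \<or> x = f u" for w x
  proof
    assume "w \<rightarrow> x"
    have wx: "w \<in> exposed (swap x)" "x \<in> exposed (swap x)" using swap(2)[OF that(3)] that by auto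
    have "w \<noteq> x" using \<open>w \<rightarrow> x\<close> not_adj_self by metis
    moreover have "card (exposed (swap x)) \<le> card (exposed g)" if "matching g" for g
      using card_swap[OF \<open>x = u \<or> x = f u\<close>] optimalD(2)[OF f that] by simp
    ultimately show False
      using minimal_pairing_independent[OF finite_verts symp_adj swap(1)[OF that(3)] _ wx]
        \<open>w \<rightarrow> x\<close> by blast
  qed
  define g where "g = swap u"
  have g: "matching g" "exposed g = insert u (exposed f - {z})" "card (exposed g) = card (exposed f)"
    using swap card_swap by (auto simp: g_def)
  have sub: "neutral g - {u} \<subseteq> neutral f - {z}"
  proof
    fix w assume w: "w \<in> neutral g - {u}"
    then have wW: "w \<in> exposed f" "w \<noteq> z" using g(2) by (auto simp: neutral_def)
    have "w \<rightarrow> x \<longleftrightarrow> w \<rightarrow> f x" if "x \<in> verts G" for x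
    proof (cases "x = u \<or> x = f u \<or> x = z")
      \<comment> \<open>The matching changes only at these three vertices: \<open>w\<close> sees
        neither \<open>u\<close> nor \<open>f u\<close>, and at \<open>z\<close> the condition is
        trivial since \<open>f z = z\<close>.\<close>
      case True
      then show ?thesis using no_adj[OF wW] fu zW by (auto simp: unpaired_def)
    next
      case False
      then have "g x = f x" by (auto simp: g_def swap_def)
      then show ?thesis using w that by (auto simp: neutral_def)
    qed
    then show "w \<in> neutral f - {z}" using wW by (auto simp: neutral_def)
  qed
  \<comment> \<open>Dropping \<open>z\<close> already costs one neutral vertex, so only a neutral
    \<open>u\<close> can restore the minimum.\<close>
  have le: "card (neutral f) \<le> card (neutral g)" using optimalD(3)[OF f g(1,3)] .
  have cz: "card (neutral f - {z}) < card (neutral f)"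
    using z finite_neutral by (intro psubset_card_mono) auto
  have "card (neutral g - {u}) \<le> card (neutral f - {z})"
    using sub finite_neutral by (intro card_mono) auto
  with le cz have "card (neutral g - {u}) < card (neutral g)" by simp
  then have un: "u \<in> neutral g" by (cases "u \<in> neutral g") auto
  with \<open>card (neutral g - {u}) \<le> _\<close> z finite_neutral[of f] finite_neutral[of g] le
  have "card (neutral g) = card (neutral f)"
    by (simp add: card_Diff_singleton_if) (metis Suc_pred card_gt_0_iff empty_iff le_antisym Suc_le_mono)
  with optimal_transfer[OF f g(1,3)] un g(2) show ?thesis by blast
qed

text \<open>The hole is moved along a path from \<open>z\<close>, one swap per edge. The claim
  \<open>v \<notin> exposed f - {z}\<close> is carried along so that removing \<open>v\<close> from
  \<open>exposed g\<close> gives back exactly \<open>exposed f - {z}\<close>; it persists because a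
  neighbour of an exposed vertex is matched.\<close>

lemma optimal_reachable:
  assumes f: "optimal f" and z: "z \<in> neutral f" and "z \<rightarrow>\<^sup>* v"
  shows "\<exists>g. optimal g \<and> v \<in> neutral g \<and> v \<notin> exposed f - {z} \<and>
    exposed g = insert v (exposed f - {z})"
  using \<open>z \<rightarrow>\<^sup>* v\<close>
proof (induction rule: reachable_induct)
  case base
  show ?case using f z neutral_subset by (intro exI[of _ f]) auto
next
  case (step v u)
  then obtain g where g: "optimal g" "v \<in> neutral g" "v \<notin> exposed f - {z}"
    "exposed g = insert v (exposed f - {z})" by blast
  obtain h where h: "optimal h" "u \<in> neutral h" "exposed h = insert u (exposed g - {v})"
    using optimal_swap[OF g(1,2) \<open>v \<rightarrow> u\<close>] by blast
  have "u \<notin> exposed g"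
    using optimal_independent[OF g(1), of v u] \<open>v \<rightarrow> u\<close> g(2) neutral_subset by blast
  then show ?case using g h by (intro exI[of _ h]) auto
qed

lemma scc_of_inter_exposed:
  assumes "optimal f" "z \<in> neutral f"
  shows "scc_of z \<inter> exposed f = {z}"
proof -
  have "z \<in> verts G" "z \<in> exposed f" using assms(2) by (auto simp: neutral_def unpaired_def)
  then show ?thesis
    using optimal_reachable[OF assms] in_scc_of_self by (auto simp: scc_of_def)
qed

section \<open>Perfect matchings of induced subgraphs\<close>

lemma uedges_induce: "uedges (G \<restriction> S) = {{u, v} | u v. u \<in> S \<and> v \<in> S \<and> u \<rightarrow> v}"
proof -
  have "uedges (G \<restriction> S) = {{tail G a, head G a} | a. a \<in> arcs G \<and> tail G a \<in> S \<and> head G a \<in> S}"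
    by (auto simp: uedges_def induce_subgraph_def)
  then show ?thesis by (auto simp: arcs_ends_conv)
qed

lemma perfect_matching_of_pairing:
  assumes "pairing S (\<lambda>u v. u \<rightarrow> v) f" "\<And>x. x \<in> S \<Longrightarrow> f x \<noteq> x"
  shows "perfect_matching (G \<restriction> S) {{x, f x} | x. x \<in> S}"
  unfolding perfect_matching_def uedges_induce
proof (intro conjI ballI)
  show "{{x, f x} | x. x \<in> S} \<subseteq> {{u, v} | u v. u \<in> S \<and> v \<in> S \<and> u \<rightarrow> v}"
    using assms by (fastforce simp: pairing_def)
  fix v assume "v \<in> verts (G \<restriction> S)"
  then have "v \<in> S" by simp
  then show "\<exists>!e. e \<in> {{x, f x} | x. x \<in> S} \<and> v \<in> e"
    using pairingD(2)[OF assms(1)] by (intro ex1I[of _ "{v, f v}"]) auto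
qed

lemma pairing_of_perfect_matching:
  assumes M: "perfect_matching (G \<restriction> S) M"
  shows "\<exists>p. pairing S (\<lambda>u v. u \<rightarrow> v) p \<and> (\<forall>x\<in>S. p x \<noteq> x) \<and> (\<forall>e\<in>M. \<exists>x\<in>S. e = {x, p x})"
proof -
  have sub: "M \<subseteq> {{u, v} | u v. u \<in> S \<and> v \<in> S \<and> u \<rightarrow> v}"
    and ex1: "\<And>v. v \<in> S \<Longrightarrow> \<exists>!e. e \<in> M \<and> v \<in> e"
    using M by (auto simp: perfect_matching_def uedges_induce)
  have "\<exists>y. {x, y} \<in> M \<and> x \<rightarrow> y \<and> y \<in> S" if "x \<in> S" for x
  proof -
    from ex1[OF that] obtain e where "e \<in> M" "x \<in> e" by blast
    with sub obtain u v where "e = {u, v}" "u \<rightarrow> v" "u \<in> S" "v \<in> S" by blast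
    with \<open>e \<in> M\<close> \<open>x \<in> e\<close> adj_commute show ?thesis by (auto simp: insert_commute)
  qed
  then obtain p where p: "\<And>x. x \<in> S \<Longrightarrow> {x, p x} \<in> M \<and> x \<rightarrow> p x \<and> p x \<in> S" by metis
  have ne: "p x \<noteq> x" if "x \<in> S" for x using p[OF that] not_adj_self by metis
  have "p (p x) = x" if "x \<in> S" for x
  proof -
    have "{p x, p (p x)} = {x, p x}" using ex1[of "p x"] p[OF that] p[of "p x"] by blast
    then show ?thesis using ne[OF that] ne[of "p x"] p[OF that] by (auto simp: doubleton_eq_iff)
  qed
  moreover have "\<exists>x\<in>S. e = {x, p x}" if "e \<in> M" for e
  proof -
    from sub that obtain u v where "e = {u, v}" "u \<in> S" by blast
    with ex1[of u] p[of u] that show ?thesis by blast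
  qed
  ultimately show ?thesis using p ne by (intro exI[of _ p]) (auto simp: pairing_def)
qed

lemma scc_of_adj:
  assumes "x \<in> scc_of z" "x \<rightarrow> y"
  shows "y \<in> scc_of z"
  using assms adj_commute reachable_adj_trans adj_reachable_trans unfolding scc_of_def by blast

lemma scc_of_matching:
  assumes "matching f" "x \<in> scc_of z"
  shows "f x \<in> scc_of z"
proof -
  have "x \<in> verts G" using assms(2) by (auto simp: scc_of_def reachable_in_verts)
  with pairingD(3)[OF assms(1), of x] scc_of_adj[OF assms(2)] assms(2) show ?thesis by metis
qed

text \<open>
  Rematching the component of a neutral vertex changes neither the exposed vertices nor the
  neutrality of those outside the component, so optimality forces the exposed vertex of the
  component to stay neutral.
\<close>

lemma tight_component_scc_of:
  assumes f: "optimal f" and z: "z \<in> neutral f"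
  shows "tight_component G (scc_of z)"
proof -
  define T where "T = scc_of z"
  have zV: "z \<in> verts G" using z by (auto simp: neutral_def unpaired_def)
  have T: "T \<in> sccs_verts" unfolding T_def using zV by (rule scc_of_in_sccs_verts)
  have TV: "T \<subseteq> verts G" using T by (rule sccs_verts_subsets)
  \<comment> \<open>Any vertex of the component can be made its only exposed vertex, and a neutral
    one.\<close>
  have exch: "\<exists>g. optimal g \<and> v \<in> neutral g \<and> exposed g \<inter> T = {v}" if "v \<in> T" for v
  proof -
    have "z \<rightarrow>\<^sup>* v" using that by (simp add: T_def scc_of_def)
    from optimal_reachable[OF f z this] obtain g where
      "optimal g" "v \<in> neutral g" "exposed g = insert v (exposed f - {z})" by blast
    with that scc_of_inter_exposed[OF f z] show ?thesis
      by (intro exI[of _ g]) (auto simp: T_def)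
  qed
  have "\<exists>M. perfect_matching (G \<restriction> (T - {v})) M" if v: "v \<in> T" for v
  proof -
    obtain g where g: "optimal g" "exposed g \<inter> T = {v}" using exch[OF v] by blast
    note M = optimalD(1)[OF g(1)]
    have gT: "g x \<in> T" if "x \<in> T" for x using scc_of_matching[OF M] that by (simp add: T_def)
    have fix_iff: "g x = x \<longleftrightarrow> x = v" if "x \<in> T" for x
      using g(2) that TV by (auto simp: unpaired_def)
    have "pairing (T - {v}) (\<lambda>u v. u \<rightarrow> v) g"
      unfolding pairing_def
    proof (intro ballI)
      fix x assume x: "x \<in> T - {v}"
      then have "x \<in> verts G" using TV by blast
      note gx = pairingD[OF M this]
      have "g x \<noteq> v" using gx(2) fix_iff[OF v] x by auto
      with gx gT x show "g x \<in> T - {v} \<and> g (g x) = x \<and> (g x \<noteq> x \<longrightarrow> x \<rightarrow> g x)" by blast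
    qed
    then show ?thesis using perfect_matching_of_pairing fix_iff by blast
  qed
  moreover have "\<not> (\<exists>!x. x \<in> e \<and> x \<rightarrow> v)"
    if v: "v \<in> T" and M: "perfect_matching (G \<restriction> (T - {v})) M" and e: "e \<in> M" for v M e
  proof -
    obtain g where g: "optimal g" "v \<in> neutral g" "exposed g \<inter> T = {v}" using exch[OF v] by blast
    note gM = optimalD(1)[OF g(1)]
    obtain p where p: "pairing (T - {v}) (\<lambda>u v. u \<rightarrow> v) p" "\<And>x. x \<in> T - {v} \<Longrightarrow> p x \<noteq> x"
      "\<And>e. e \<in> M \<Longrightarrow> \<exists>x\<in>T - {v}. e = {x, p x}"
      using pairing_of_perfect_matching[OF M] by blast
    \<comment> \<open>The given perfect matching replaces \<open>g\<close> inside the component;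
      \<open>v\<close> stays exposed.\<close>
    define h where "h x = (if x \<in> T - {v} then p x else g x)" for x
    have gv: "g v = v" "v \<in> verts G" using g(3) by (auto simp: unpaired_def)
    have gT: "g x \<in> T \<longleftrightarrow> x \<in> T" if "x \<in> verts G" for x
      using scc_of_matching[OF gM] pairingD(2)[OF gM that] by (metis T_def)
    have hM: "matching h"
      unfolding pairing_def
    proof (intro ballI)
      fix x assume x: "x \<in> verts G"
      show "h x \<in> verts G \<and> h (h x) = x \<and> (h x \<noteq> x \<longrightarrow> x \<rightarrow> h x)"
      proof (cases "x \<in> T - {v}")
        case True
        then show ?thesis using pairingD[OF p(1) True] TV by (auto simp: h_def)
      next
        case False
        then have "g x \<notin> T - {v}" using gT[OF x] gv by auto
        with False show ?thesis using pairingD[OF gM x] by (auto simp: h_def)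
      qed
    qed
    have hW: "exposed h = exposed g"
      using p(2) g(3) by (auto simp: unpaired_def h_def split: if_splits)
    have "neutral h \<subseteq> neutral g"
    proof
      fix w assume w: "w \<in> neutral h"
      show "w \<in> neutral g"
      proof (cases "w = v")
        case True
        with g(2) show ?thesis by simp
      next
        case False
        with w hW g(3) have wT: "w \<notin> T" "w \<in> exposed g" by (auto simp: neutral_def)
        \<comment> \<open>No edge leaves the component, so rematching inside it is invisible to
          \<open>w\<close>.\<close>
        have nT: "\<not> w \<rightarrow> x" if "x \<in> T" for x
          using scc_of_adj[of x z w] that wT(1) adj_commute by (auto simp: T_def)
        have "w \<rightarrow> x \<longleftrightarrow> w \<rightarrow> g x" if x: "x \<in> verts G" for x
        proof (cases "x \<in> T")
          case True
          then show ?thesis using nT gT[OF x] by blast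
        next
          case False
          then show ?thesis using w x by (auto simp: neutral_def h_def)
        qed
        with wT show ?thesis by (auto simp: neutral_def)
      qed
    qed
    moreover have "card (neutral g) \<le> card (neutral h)"
      using optimalD(3)[OF g(1) hM] hW by simp
    ultimately have "neutral h = neutral g"
      by (intro card_seteq finite_neutral)
    with g(2) have "v \<in> neutral h" by simp
    moreover obtain x where x: "x \<in> T - {v}" "e = {x, p x}" using p(3)[OF e] by blast
    moreover have "x \<in> verts G" "h x = p x" using x(1) TV by (auto simp: h_def)
    \<comment> \<open>Neutrality of \<open>v\<close> with respect to \<open>h\<close>, read at the
      edge \<open>e\<close>, is condition (ii) of tightness.\<close>
    ultimately have "v \<rightarrow> x \<longleftrightarrow> v \<rightarrow> p x"
      unfolding neutral_def by fastforce
    with x p(2)[OF x(1)] show ?thesis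
      using adj_commute[of v x] adj_commute[of v "p x"] by auto
  qed
  ultimately show ?thesis using T by (auto simp: tight_component_def T_def)
qed

text \<open>The component of a neutral vertex contains no other exposed vertex, so distinct neutral
  vertices have distinct components.\<close>

lemma card_neutral_le:
  assumes f: "optimal f"
  shows "card (neutral f) \<le> card {T. tight_component G T}"
proof (rule card_inj_on_le)
  show "inj_on scc_of (neutral f)"
    using scc_of_inter_exposed[OF f] by (intro inj_onI) (metis singleton_inject)
  show "scc_of ` neutral f \<subseteq> {T. tight_component G T}"
    using tight_component_scc_of[OF f] by blast
  show "finite {T. tight_component G T}"
    using finite_sccs_verts by (rule rev_finite_subset) (auto simp: tight_component_def)
qed

section \<open>The cut of a signing\<close>

definition adj_ind :: "'a \<Rightarrow> 'a \<Rightarrow> real" where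
  "adj_ind u v = of_bool (u \<rightarrow> v)"

lemma adj_ind_commute: "adj_ind u v = adj_ind v u"
  by (simp add: adj_ind_def adj_commute)

text \<open>Without loops and with \<open>Q\<close> symmetric, each edge arises from exactly two
  ordered pairs.\<close>

lemma card_adj_pairs:
  assumes "symp Q"
  shows "card {(u, v). u \<rightarrow> v \<and> Q u v} = 2 * card {{u, v} | u v. u \<rightarrow> v \<and> Q u v}"
proof -
  define P where "P = {(u, v). u \<rightarrow> v \<and> Q u v}"
  define e where "e p = {fst p, snd p}" for p :: "'a \<times> 'a"
  have fin: "finite P"
    by (rule finite_subset[of _ "verts G \<times> verts G"]) (auto simp: P_def dest: adj_verts)
  have "card P = (\<Sum>x\<in>e ` P. card {p \<in> P. e p = x})"
    using sum.image_gen[OF fin, of "\<lambda>_. 1 :: nat" e] by simp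
  also have "\<dots> = (\<Sum>x\<in>e ` P. 2)"
  proof (rule sum.cong[OF refl])
    fix x assume "x \<in> e ` P"
    then obtain u v where uv: "(u, v) \<in> P" "x = {u, v}" by (auto simp: e_def)
    then have "(v, u) \<in> P" "u \<noteq> v"
      using assms adj_commute not_adj_self by (auto simp: P_def dest: sympD)
    with uv have "{p \<in> P. e p = x} = {(u, v), (v, u)}" by (auto simp: e_def doubleton_eq_iff)
    with \<open>u \<noteq> v\<close> show "card {p \<in> P. e p = x} = 2" by simp
  qed
  also have "e ` P = {{u, v} | u v. u \<rightarrow> v \<and> Q u v}"
    by (auto simp: e_def P_def image_iff; (blast | force))
  finally show ?thesis by (simp add: P_def)
qed

lemma uedges_adj: "uedges G = {{u, v} | u v. u \<rightarrow> v}"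
  unfolding uedges_def by (auto simp: arcs_ends_conv)

text \<open>On an adjacent pair \<open>s u * s v\<close> is 1 minus twice the indicator of being
  cut, so the form equals twice the number of edges minus four times the size of the cut.\<close>

lemma card_cut:
  assumes "\<And>x. s x = 1 \<or> s x = (-1 :: real)"
  shows "real (card (edges_between G {v \<in> verts G. s v = 1} {v \<in> verts G. s v = -1}))
    = card (uedges G) / 2 - (\<Sum>u\<in>verts G. \<Sum>v\<in>verts G. adj_ind u v * s u * s v) / 4"
proof -
  define V where "V = verts G"
  have fin: "finite (V \<times> V)" by (simp add: V_def)
  define P where "P = {(u, v). u \<rightarrow> v}"
  define C where "C = {(u, v). u \<rightarrow> v \<and> s u \<noteq> s v}"
  have sub: "P \<subseteq> V \<times> V" "C \<subseteq> P" by (auto simp: P_def C_def V_def dest: adj_verts)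
  then have finP: "finite P" using fin finite_subset by blast
  have cP: "card P = 2 * card (uedges G)"
    using card_adj_pairs[of "\<lambda>_ _. True"] by (simp add: P_def uedges_adj symp_def)
  have "edges_between G {v \<in> V. s v = 1} {v \<in> V. s v = -1} = {{u, v} | u v. u \<rightarrow> v \<and> s u \<noteq> s v}"
    (is "?L = ?R")
  proof (intro set_eqI iffI)
    fix e assume "e \<in> ?L"
    then obtain u v where "{u, v} \<in> uedges G" "e = {u, v}" "s u = 1" "s v = -1"
      by (auto simp: edges_between_def)
    then show "e \<in> ?R"
      by (auto simp: uedges_adj doubleton_eq_iff adj_commute) (use adj_commute in force)+
  next
    fix e assume "e \<in> ?R"
    then obtain u v where e: "e = {u, v}" "u \<rightarrow> v" "s u \<noteq> s v" by blast
    then have "u \<in> V" "v \<in> V" by (auto simp: V_def dest: adj_verts)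
    with e assms[of u] assms[of v] show "e \<in> ?L"
      by (auto simp: edges_between_def uedges_adj insert_commute)
  qed
  then have cC: "card C = 2 * card (edges_between G {v \<in> V. s v = 1} {v \<in> V. s v = -1})"
    using card_adj_pairs[of "\<lambda>u v. s u \<noteq> s v"] by (simp add: C_def symp_def)
  have "(\<Sum>u\<in>V. \<Sum>v\<in>V. adj_ind u v * s u * s v)
      = (\<Sum>(u, v)\<in>V \<times> V. adj_ind u v * s u * s v)"
    by (simp add: sum.cartesian_product)
  also have "\<dots> = (\<Sum>(u, v)\<in>P. s u * s v)"
    using sub fin by (intro sum.mono_neutral_cong_right) (auto simp: P_def adj_ind_def)
  also have "\<dots> = (\<Sum>p\<in>P. 1 - 2 * (if p \<in> C then 1 else 0))"
  proof (rule sum.cong[OF refl])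
    fix p assume "p \<in> P"
    obtain u v where "p = (u, v)" by fastforce
    with \<open>p \<in> P\<close> have "u \<rightarrow> v" by (simp add: P_def)
    with \<open>p = (u, v)\<close> show "(case p of (u, v) \<Rightarrow> s u * s v) = 1 - 2 * (if p \<in> C then 1 else 0)"
      using assms[of u] assms[of v] by (auto simp: C_def)
  qed
  also have "\<dots> = real (card P) - 2 * real (card C)"
    using finP sub(2) by (simp add: sum_subtractf sum_distrib_left[symmetric]
        sum.inter_restrict[symmetric] Int_absorb1)
  finally show ?thesis
    using cP cC by (simp add: V_def diff_divide_distrib)
qed

section \<open>Clusters\<close>

text \<open>If \<open>x\<close> and \<open>f x\<close> carry opposite signs, the adjacencies of
  \<open>w\<close> to this pair add up to \<open>s w * s x * coef f w x\<close>.\<close>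

definition coef :: "('a \<Rightarrow> 'a) \<Rightarrow> 'a \<Rightarrow> 'a \<Rightarrow> real" where
  "coef f w x = adj_ind w x - adj_ind w (f x)"

lemma coef_diff_abs: "coef f w x \<noteq> coef f w' x \<Longrightarrow> \<bar>coef f w x - coef f w' x\<bar> \<ge> 1"
  by (auto simp: coef_def adj_ind_def)

lemma card_neighbours_le:
  assumes "x \<in> verts G"
  shows "card {y. x \<rightarrow> y} \<le> max_degree G"
proof -
  have "{y. x \<rightarrow> y} \<subseteq> head G ` out_arcs G x"
    by (auto simp: arcs_ends_conv)
  then have "card {y. x \<rightarrow> y} \<le> out_degree G x"
    unfolding out_degree_def by (rule surj_card_le[OF finite_out_arcs])
  also have "\<dots> \<le> max_degree G"
    using assms by (auto simp: max_degree_def intro: Max_ge)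
  finally show ?thesis .
qed

lemma card_coef_class_le:
  assumes M: "matching f" and x: "x \<in> verts G" and ne: "coef f w0 x \<noteq> 0"
  shows "card {w \<in> exposed f. coef f w x = coef f w0 x} + 1 \<le> max_degree G"
proof -
  note fx = pairingD[OF M x]
  \<comment> \<open>A nonzero coefficient is 1 or -1, and its sign tells which endpoint the whole
    class sees. The matched neighbour \<open>f y\<close> lies outside the class and accounts for the
    \<open>+ 1\<close>.\<close>
  define y where "y = (if w0 \<rightarrow> x then x else f x)"
  have fx_ne: "f x \<noteq> x" using ne by (auto simp: coef_def)
  then have y_facts: "y \<in> verts G" "f y \<in> verts G" "f (f y) = y" "f y \<noteq> y"
    using fx x by (auto simp: y_def)
  have ynbr: "w \<rightarrow> y" if "coef f w x = coef f w0 x" for w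
    using ne that by (auto simp: y_def coef_def adj_ind_def of_bool_def split: if_splits)
  define C where "C = {w \<in> exposed f. coef f w x = coef f w0 x}"
  have "insert (f y) C \<subseteq> {z. y \<rightarrow> z}"
    using ynbr pairingD(3)[OF M y_facts(1)] y_facts(4) adj_commute by (auto simp: C_def)
  moreover have "f y \<notin> C" using y_facts by (auto simp: C_def unpaired_def)
  moreover have "finite C" using finite_exposed by (simp add: C_def)
  moreover have "finite {z. y \<rightarrow> z}"
    by (rule finite_subset[OF _ finite_verts]) (auto dest: adj_verts)
  ultimately have "card C + 1 \<le> card {z. y \<rightarrow> z}"
    by (metis Suc_eq_plus1 card_insert_disjoint card_mono)
  with card_neighbours_le[OF y_facts(1)] show ?thesis by (simp add: C_def)
qed

text \<open>A class with all coefficients zero consists of neutral vertices, counted by tight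
  components; any other class lies in the neighbourhood of one matched vertex.\<close>

lemma coef_class_le:
  assumes f: "optimal f" and w0: "w0 \<in> exposed f"
  shows "real (card {w \<in> exposed f. \<forall>x\<in>verts G. coef f w x = coef f w0 x})
    \<le> max (real (card {T. tight_component G T})) (real (max_degree G) - 1)"
    (is "real (card ?C) \<le> _")
proof (cases "\<forall>x\<in>verts G. coef f w0 x = 0")
  case True
  then have "?C \<subseteq> neutral f"
    by (auto simp: neutral_def coef_def adj_ind_def of_bool_eq_iff)
  then have "card ?C \<le> card (neutral f)" by (rule card_mono[OF finite_neutral])
  with card_neutral_le[OF f] show ?thesis by linarith
next
  case False
  then obtain x where x: "x \<in> verts G" "coef f w0 x \<noteq> 0" by blast
  have "card ?C \<le> card {w \<in> exposed f. coef f w x = coef f w0 x}"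
    using x(1) finite_exposed by (intro card_mono) auto
  with card_coef_class_le[OF optimalD(1)[OF f] x] show ?thesis by linarith
qed


text \<open>Partners under \<open>h\<close> share a cluster and have opposite signs, so later flips
  of whole clusters cannot spoil the balance. Only within-cluster terms are estimated here.\<close>

lemma exists_good_clusters:
  assumes M: "matching f" and indep: "\<And>x y. x \<in> exposed f \<Longrightarrow> y \<in> exposed f \<Longrightarrow> \<not> x \<rightarrow> y"
    and K: "0 \<le> K" "\<And>w0. w0 \<in> exposed f \<Longrightarrow>
      real (card {w \<in> exposed f. \<forall>x\<in>verts G. coef f w x = coef f w0 x}) \<le> K"
  shows "\<exists>h (s :: 'a \<Rightarrow> real) (\<kappa> :: 'a \<Rightarrow> 'a set).
    pairing (verts G) (\<lambda>_ _. True) h \<and> card (unpaired (verts G) h) \<le> 1 \<and>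
    (\<forall>x. s x = 1 \<or> s x = -1) \<and> (\<forall>x\<in>verts G. \<kappa> (h x) = \<kappa> x \<and> (h x \<noteq> x \<longrightarrow> s (h x) = - s x)) \<and>
    (\<Sum>u\<in>verts G. \<Sum>v\<in>verts G. if \<kappa> u = \<kappa> v then adj_ind u v * s u * s v else 0)
      \<le> K - real (card (verts G))"
proof -
  define V where "V = verts G"
  define W where "W = exposed f"
  define Mt where "Mt = {x \<in> V. f x \<noteq> x}"
  have fin: "finite V" "finite W" "finite Mt" by (auto simp: V_def W_def Mt_def unpaired_def)
  have VW: "V = Mt \<union> W" "Mt \<inter> W = {}" by (auto simp: V_def W_def Mt_def unpaired_def)
  note fV = pairingD[OF M, folded V_def]
  have fW: "f w = w" if "w \<in> W" for w using that by (auto simp: W_def unpaired_def)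
  have fMt: "f x \<in> Mt" "f (f x) = x" "f x \<noteq> x" "adj_ind x (f x) = 1" if "x \<in> Mt" for x
    using fV[of x] that by (auto simp: Mt_def adj_ind_def)

  define D where "D w w' \<longleftrightarrow> (\<exists>x\<in>V. coef f w x \<noteq> coef f w' x)" for w w'
  have D_commute: "D w w' \<longleftrightarrow> D w' w" for w w' unfolding D_def by metis
  have "symp D" by (rule sympI) (use D_commute in blast)
  then obtain g1 where g1: "pairing W D g1"
    and g1_max: "\<And>x y. x \<in> unpaired W g1 \<Longrightarrow> y \<in> unpaired W g1 \<Longrightarrow> x \<noteq> y \<Longrightarrow> \<not> D x y"
    using exists_maximal_pairing[OF fin(2)] by blast
  \<comment> \<open>By maximality of \<open>g1\<close> the leftover vertices have identical
    coefficients, so they form part of one class and \<open>K\<close> bounds their number.\<close>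
  define U where "U = unpaired W g1"
  have U: "U \<subseteq> W" "finite U" using fin by (auto simp: U_def unpaired_def)
  have card_U: "real (card U) \<le> K"
  proof (cases "U = {}")
    case False
    then obtain w0 where w0: "w0 \<in> U" by blast
    have "U \<subseteq> {w \<in> W. \<forall>x\<in>V. coef f w x = coef f w0 x}"
      using g1_max[OF w0[unfolded U_def]] U(1) by (fastforce simp: D_def U_def)
    then have "card U \<le> card {w \<in> W. \<forall>x\<in>V. coef f w x = coef f w0 x}"
      using fin by (intro card_mono) auto
    with K(2)[of w0] w0 U(1) show ?thesis by (force simp: W_def V_def)
  qed (use K in simp)
  \<comment> \<open>The leftover vertices are paired arbitrarily, for balance only; at most one
    stays single.\<close>
  obtain g2 where g2: "pairing U (\<lambda>_ _. True) g2"
    and g2_max: "\<And>x y. x \<in> unpaired U g2 \<Longrightarrow> y \<in> unpaired U g2 \<Longrightarrow> x = y"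
    using exists_maximal_pairing[OF U(2), of "\<lambda>_ _. True"] by (auto simp: symp_def)
  define g where "g x = (if x \<in> U then g2 x else g1 x)" for x
  have gW: "g w \<in> W" "g (g w) = w" if "w \<in> W" for w
  proof -
    have "g1 w \<notin> U" if "w \<notin> U"
      using that \<open>w \<in> W\<close> pairingD(1,2)[OF g1 \<open>w \<in> W\<close>] by (auto simp: U_def unpaired_def)
    then show "g w \<in> W" "g (g w) = w"
      using pairingD(1,2)[OF g1 \<open>w \<in> W\<close>] pairingD(1,2)[OF g2, of w] U(1)
      by (auto simp: g_def)
  qed
  have g_diff: "D w (g w)" if "w \<in> W - U" for w
    using pairingD(3)[OF g1, of w] that by (auto simp: g_def U_def unpaired_def)
  define h where "h x = (if f x \<noteq> x then f x else g x)" for x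
  have hW: "h w = g w" if "w \<in> W" for w using fW[OF that] by (simp add: h_def)
  have hMt: "h x = f x" if "x \<in> Mt" for x using fMt[OF that] by (simp add: h_def)
  have h: "pairing V (\<lambda>_ _. True) h"
    unfolding pairing_def VW(1) using hW hMt fMt gW by auto
  have unpaired_h: "unpaired V h \<subseteq> unpaired U g2"
    using hW hMt fMt g_diff by (auto simp: unpaired_def VW(1) g_def D_def split: if_splits) metis+
  have card_h: "card (unpaired V h) \<le> 1"
  proof -
    have "finite (unpaired V h)" using fin by (simp add: unpaired_def)
    moreover have "\<forall>x\<in>unpaired V h. \<forall>y\<in>unpaired V h. x = y"
      using g2_max unpaired_h by blast
    ultimately show ?thesis by (simp add: card_le_Suc0_iff_eq)
  qed

  obtain r :: "'a \<Rightarrow> real" where r: "\<And>x. r x = 1 \<or> r x = -1"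
    "\<And>x. x \<in> V \<Longrightarrow> h x \<noteq> x \<Longrightarrow> r (h x) = - r x"
    using pairing_orientation[OF h] by blast
  \<comment> \<open>an endpoint of the matching edge to whose cluster \<open>w\<close> and \<open>g w\<close> are attached\<close>
  define X where "X w = (SOME x. x \<in> V \<and> coef f w x \<noteq> coef f (g w) x)" for w
  have X: "X w \<in> V" "coef f w (X w) \<noteq> coef f (g w) (X w)" if "D w (g w)" for w
    using someI_ex[of "\<lambda>x. x \<in> V \<and> coef f w x \<noteq> coef f (g w) x"] that
    by (auto simp: X_def D_def)
  have X_Mt: "X w \<in> Mt" if "D w (g w)" for w
    using X[OF that] by (auto simp: Mt_def coef_def)
  \<comment> \<open>The property defining \<open>X\<close> is symmetric in \<open>w\<close> and
    \<open>g w\<close>, so both attach to the same edge.\<close>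
  have X_g: "X (g w) = X w" if "w \<in> W" for w
    unfolding X_def gW(2)[OF that] by (rule arg_cong[of _ _ Eps]) (intro ext, metis)
  \<comment> \<open>The sign of an attached vertex makes the joint contribution of \<open>w\<close>
    and \<open>g w\<close> equal to minus the absolute difference of their coefficients at
    \<open>X w\<close>.\<close>
  define s where "s x = (if x \<in> W \<and> D x (g x)
      then - r (X x) * sgn (coef f x (X x) - coef f (g x) (X x)) else r x)" for x
  \<comment> \<open>Clusters are labelled by vertex pairs. Several attached pairs may share one
    edge, harmlessly, since exposed vertices are pairwise nonadjacent.\<close>
  define \<kappa> where "\<kappa> x = (if x \<in> Mt then {x, f x}
      else if D x (g x) then {X x, f (X x)} else {x, g x})" for x
  have s_sg: "s x = 1 \<or> s x = -1" for x
    using r(1)[of x] r(1)[of "X x"] X(2)[of x] by (auto simp: s_def sgn_real_def)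
  have s_Mt: "s x = r x" if "x \<in> Mt" for x using that VW(2) by (auto simp: s_def)
  have sh: "s (h x) = - s x" if "x \<in> V" "h x \<noteq> x" for x
  proof (cases "x \<in> Mt")
    case True
    then show ?thesis using r(2)[OF that] hMt s_Mt fMt(1) by metis
  next
    case False
    with that VW have x: "x \<in> W" by blast
    have "sgn (coef f (g x) (X x) - coef f x (X x)) = - sgn (coef f x (X x) - coef f (g x) (X x))"
      by (simp add: sgn_minus[symmetric])
    with x show ?thesis
      using r(2)[OF that] hW gW[OF x] X_g[OF x] D_commute[of x "g x"] by (auto simp: s_def)
  qed
  have \<kappa>h: "\<kappa> (h x) = \<kappa> x" if "x \<in> V" for x
  proof (cases "x \<in> Mt")
    case True
    then show ?thesis using hMt fMt[OF True] by (auto simp: \<kappa>_def)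
  next
    case False
    with that VW have x: "x \<in> W" by blast
    then show ?thesis
      using hW gW[OF x] X_g[OF x] D_commute[of x "g x"] VW(2) by (auto simp: \<kappa>_def)
  qed

  define B where "B u v = (if \<kappa> u = \<kappa> v then adj_ind u v * s u * s v else 0)" for u v
  have B_commute: "B u v = B v u" for u v
    by (simp add: B_def adj_ind_commute[of u v] mult_ac)
  define t where "t w = (if D w (g w) then s w * r (X w) * coef f w (X w) else 0)" for w
  \<comment> \<open>The cluster of \<open>u\<close> meets \<open>Mt\<close> only in \<open>u\<close>
    and \<open>f u\<close>, which are adjacent with opposite signs.\<close>
  have Mt_Mt: "(\<Sum>v\<in>Mt. B u v) = -1" if u: "u \<in> Mt" for u
  proof -
    have "(\<Sum>v\<in>Mt. B u v) = (\<Sum>v\<in>{u, f u}. B u v)"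
      using u fMt[OF u] fin
      by (intro sum.mono_neutral_right) (auto simp: B_def \<kappa>_def doubleton_eq_iff)
    also have "\<dots> = -1"
    proof -
      have "s (f u) = - s u" using sh[of u] hMt[OF u] fMt(3)[OF u] u VW(1) by auto
      moreover have "\<kappa> (f u) = \<kappa> u" using \<kappa>h[of u] hMt[OF u] u VW(1) by auto
      moreover have "B u u = 0" using not_adj_self by (simp add: B_def adj_ind_def)
      ultimately have "B u u + B u (f u) = -1"
        using fMt(4)[OF u] s_sg[of u] by (auto simp: B_def)
      then show ?thesis using fMt(3)[OF u] by simp
    qed
    finally show ?thesis .
  qed
  have W_W: "(\<Sum>v\<in>W. B u v) = 0" if u: "u \<in> W" for u
    using indep u by (intro sum.neutral) (auto simp: B_def adj_ind_def W_def)
  have W_Mt: "(\<Sum>v\<in>Mt. B u v) = t u" if u: "u \<in> W" for u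
  proof (cases "D u (g u)")
    case True
    note x = X_Mt[OF True]
    have \<kappa>u: "\<kappa> u = {X u, f (X u)}" using True u VW(2) by (auto simp: \<kappa>_def)
    have "(\<Sum>v\<in>Mt. B u v) = (\<Sum>v\<in>{X u, f (X u)}. B u v)"
    proof (rule sum.mono_neutral_right)
      have "\<kappa> v \<noteq> \<kappa> u" if "v \<in> Mt - {X u, f (X u)}" for v
        using that \<kappa>u by (auto simp: \<kappa>_def)
      then show "\<forall>v\<in>Mt - {X u, f (X u)}. B u v = 0" by (metis B_def)
    qed (use x fMt(1)[OF x] fin in auto)
    also have "\<dots> = B u (X u) + B u (f (X u))" using fMt[OF x] by simp
    also have "\<dots> = adj_ind u (X u) * s u * s (X u) + adj_ind u (f (X u)) * s u * s (f (X u))"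
      using x fMt[OF x] by (simp add: B_def \<kappa>u) (simp add: \<kappa>_def insert_commute)
    also have "s (f (X u)) = - s (X u)" using sh[OF X(1)[OF True]] hMt[OF x] fMt[OF x] by simp
    finally show ?thesis
      using True s_Mt[OF x] by (simp add: t_def coef_def algebra_simps)
  next
    case False
    then have "\<kappa> u = {u, g u}" using u VW(2) by (auto simp: \<kappa>_def)
    moreover have "u \<notin> \<kappa> v" if "v \<in> Mt" for v
      using that fMt[OF that] u VW(2) by (auto simp: \<kappa>_def)
    ultimately have "\<forall>v\<in>Mt. B u v = 0" by (fastforce simp: B_def)
    with False show ?thesis by (simp add: t_def)
  qed
  \<comment> \<open>Coefficients are integers, so where they differ the gain is at least 1.\<close>
  have t_pair: "t w + t (g w) \<le> - of_bool (D w (g w))" if w: "w \<in> W" for w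
  proof (cases "D w (g w)")
    case True
    define d where "d = coef f w (X w) - coef f (g w) (X w)"
    have d: "\<bar>d\<bar> \<ge> 1" using coef_diff_abs X(2)[OF True] by (simp add: d_def)
    have "g w \<noteq> w" using True by (auto simp: D_def)
    then have "s (g w) = - s w" using sh[of w] hW[OF w] w VW(1) by auto
    moreover have "D (g w) (g (g w))" using True gW[OF w] D_commute by simp
    ultimately have "t w + t (g w) = s w * r (X w) * d"
      using True X_g[OF w] by (simp add: t_def d_def algebra_simps)
    also have "\<dots> = - (r (X w) * r (X w)) * (sgn d * d)"
      using True w by (simp add: s_def d_def)
    also have "\<dots> = - \<bar>d\<bar>" using r(1)[of "X w"] by (auto simp: mult.commute abs_sgn)
    finally show ?thesis using d True by simp
  next
    case False
    then show ?thesis using gW[OF w] D_commute by (simp add: t_def)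
  qed
  have "pairing W (\<lambda>_ _. True) g" using gW by (simp add: pairing_def)
  then have "2 * (\<Sum>w\<in>W. t w) = (\<Sum>w\<in>W. t w + t (g w))" by (rule sum_pairing)
  also have "\<dots> \<le> (\<Sum>w\<in>W. - of_bool (D w (g w)))" by (rule sum_mono[OF t_pair])
  also have "\<dots> \<le> (\<Sum>w\<in>W. - of_bool (w \<notin> U))" using g_diff by (intro sum_mono) auto
  also have "\<dots> = - real (card (W - U))"
  proof -
    have "W \<inter> {w. w \<notin> U} = W - U" by blast
    then show ?thesis using fin by (simp add: sum_negf)
  qed
  also have "\<dots> = real (card U) - real (card W)"
    using U fin card_mono[OF fin(2) U(1)] by (simp add: card_Diff_subset)
  finally have t_sum: "2 * (\<Sum>w\<in>W. t w) \<le> K - real (card W)" using card_U by linarith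
  have split: "(\<Sum>v\<in>V. k v) = (\<Sum>v\<in>Mt. k v) + (\<Sum>v\<in>W. k v)" for k :: "'a \<Rightarrow> real"
    unfolding VW(1) using fin VW(2) by (intro sum.union_disjoint)
  \<comment> \<open>By symmetry both mixed blocks equal the sum of \<open>t\<close>, which matches
    the factor 2 in \<open>t_sum\<close>.\<close>
  have Mt_W: "(\<Sum>u\<in>Mt. \<Sum>v\<in>W. B u v) = (\<Sum>w\<in>W. t w)"
    using W_Mt by (subst sum.swap) (simp add: B_commute[of _ w for w] cong: sum.cong)
  have "(\<Sum>u\<in>V. \<Sum>v\<in>V. B u v) = (\<Sum>u\<in>Mt. \<Sum>v\<in>Mt. B u v) + (\<Sum>u\<in>Mt. \<Sum>v\<in>W. B u v)
      + (\<Sum>u\<in>W. \<Sum>v\<in>Mt. B u v) + (\<Sum>u\<in>W. \<Sum>v\<in>W. B u v)"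
    by (simp add: split sum.distrib)
  also have "\<dots> = - real (card Mt) + 2 * (\<Sum>w\<in>W. t w)"
    using Mt_Mt W_W W_Mt Mt_W by simp
  also have "\<dots> \<le> K - (real (card Mt) + real (card W))" using t_sum by simp
  also have "real (card Mt) + real (card W) = real (card V)"
    using card_Un_disjoint[OF fin(3,2) VW(2)] VW(1) by simp
  finally have "(\<Sum>u\<in>V. \<Sum>v\<in>V. B u v) \<le> K - real (card V)" .
  with h card_h s_sg sh \<kappa>h show ?thesis
    unfolding V_def B_def by (intro exI[of _ h] exI[of _ s] exI[of _ \<kappa>]) auto
qed

section \<open>Balanced signs and the bisection\<close>

lemma exists_balanced_signs:
  assumes "optimal f"
  shows "\<exists>s :: 'a \<Rightarrow> real. (\<forall>x. s x = 1 \<or> s x = -1) \<and> \<bar>\<Sum>x\<in>verts G. s x\<bar> \<le> 1 \<and>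
    (\<Sum>u\<in>verts G. \<Sum>v\<in>verts G. adj_ind u v * s u * s v)
      \<le> max (real (card {T. tight_component G T})) (real (max_degree G) - 1)
        - real (card (verts G))"
proof -
  define K where "K = max (real (card {T. tight_component G T})) (real (max_degree G) - 1)"
  \<comment> \<open>The number of tight components keeps \<open>K\<close> nonnegative even when the
    maximum degree is 0.\<close>
  have "0 \<le> K" by (simp add: K_def le_max_iff_disj)
  from exists_good_clusters[OF optimalD(1)[OF assms] optimal_independent[OF assms] this
      coef_class_le[OF assms, folded K_def]]
  obtain h and s0 :: "'a \<Rightarrow> real" and \<kappa> :: "'a \<Rightarrow> 'a set"
    where h: "pairing (verts G) (\<lambda>_ _. True) h" "card (unpaired (verts G) h) \<le> 1"
      and s0: "\<And>x. s0 x = 1 \<or> s0 x = -1"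
      and hs: "\<And>x. x \<in> verts G \<Longrightarrow> \<kappa> (h x) = \<kappa> x \<and> (h x \<noteq> x \<longrightarrow> s0 (h x) = - s0 x)"
      and le0: "(\<Sum>u\<in>verts G. \<Sum>v\<in>verts G. if \<kappa> u = \<kappa> v then adj_ind u v * s0 u * s0 v else 0)
        \<le> K - real (card (verts G))"
    by blast
  obtain \<epsilon> where \<epsilon>: "\<And>i. \<epsilon> i = 1 \<or> \<epsilon> i = (-1 :: real)"
    and le: "(\<Sum>u\<in>verts G. \<Sum>v\<in>verts G. adj_ind u v * s0 u * s0 v * \<epsilon> (\<kappa> u) * \<epsilon> (\<kappa> v))
      \<le> K - real (card (verts G))"
    using exists_cluster_signs[OF finite_verts, of "\<lambda>u v. adj_ind u v * s0 u * s0 v" \<kappa>] le0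
    by (meson order_trans)
  define s where "s x = \<epsilon> (\<kappa> x) * s0 x" for x
  have sg: "s x = 1 \<or> s x = -1" for x using \<epsilon>[of "\<kappa> x"] s0[of x] by (auto simp: s_def)
  define F where "F = unpaired (verts G) h"
  have finF: "finite F" by (simp add: F_def unpaired_def)
  have "2 * (\<Sum>x\<in>verts G. s x) = (\<Sum>x\<in>verts G. s x + s (h x))" by (rule sum_pairing[OF h(1)])
  \<comment> \<open>Partners have the same cluster sign and opposite \<open>s0\<close>, so they
    cancel; only fixed points of \<open>h\<close>, at most one, remain.\<close>
  also have "\<dots> = (\<Sum>x\<in>F. 2 * s x)"
    using hs by (intro sum.mono_neutral_cong_right) (auto simp: F_def unpaired_def s_def)
  finally have "(\<Sum>x\<in>verts G. s x) = (\<Sum>x\<in>F. s x)" by (simp add: sum_distrib_left[symmetric])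
  also have "\<bar>\<dots>\<bar> \<le> (\<Sum>x\<in>F. \<bar>s x\<bar>)" by (rule sum_abs)
  also have "\<dots> = (\<Sum>x\<in>F. 1)" using sg by (intro sum.cong) (metis abs_1 abs_minus_cancel)+
  also have "\<dots> \<le> 1" using h(2) by (simp add: F_def)
  finally have "\<bar>\<Sum>x\<in>verts G. s x\<bar> \<le> 1" .
  moreover have "(\<Sum>u\<in>verts G. \<Sum>v\<in>verts G. adj_ind u v * s u * s v) \<le> K - real (card (verts G))"
    using le by (simp add: s_def mult_ac)
  ultimately show ?thesis using sg unfolding K_def by blast
qed

end

theorem theorem1p3:
  fixes G :: "('a, 'b) pre_digraph" and n m \<Delta> \<tau> :: nat
  assumes "graph G"
    and "card (verts G) = n"
    and "card (uedges G) = m"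
    and "max_degree G = \<Delta>"
    and "card {T. tight_component G T} = \<tau>"
  shows "\<exists>V1 V2. bisection G V1 V2 \<and>
    real (card (edges_between G V1 V2)) \<ge>
      real m / 2 + (real n - max (real \<tau>) (real \<Delta> - 1)) / 4"
proof -
  interpret graph G by fact
  obtain f where "optimal f" using exists_optimal by blast
  from exists_balanced_signs[OF this] obtain s :: "'a \<Rightarrow> real"
    where s: "\<And>x. s x = 1 \<or> s x = -1" and bal: "\<bar>\<Sum>x\<in>verts G. s x\<bar> \<le> 1"
      and le: "(\<Sum>u\<in>verts G. \<Sum>v\<in>verts G. adj_ind u v * s u * s v)
        \<le> max (real \<tau>) (real \<Delta> - 1) - real n"
    using assms by auto
  define V1 where "V1 = {v \<in> verts G. s v = 1}"
  define V2 where "V2 = {v \<in> verts G. s v = -1}"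
  have un: "V1 \<union> V2 = verts G" "V1 \<inter> V2 = {}" "finite V1" "finite V2"
    using s by (auto simp: V1_def V2_def)
  \<comment> \<open>The sum of the signs is the difference of the part sizes, so \<open>bal\<close>
    is the bisection condition.\<close>
  have "(\<Sum>x\<in>verts G. s x) = (\<Sum>x\<in>V1. s x) + (\<Sum>x\<in>V2. s x)"
    unfolding un(1)[symmetric] using un by (intro sum.union_disjoint)
  also have "\<dots> = real (card V1) - real (card V2)" by (simp add: V1_def V2_def)
  finally have "bisection G V1 V2" using bal un by (auto simp: bisection_def)
  moreover have "real (card (edges_between G V1 V2)) \<ge>
      real m / 2 + (real n - max (real \<tau>) (real \<Delta> - 1)) / 4"
    using card_cut[of s, OF s] le assms(3) unfolding V1_def V2_def by (simp add: field_simps)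
  ultimately show ?thesis by blast
qed

end
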